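(* Let $\lambda,\eta,\mu\in\mathbb{R}$, let $\Omega\subset\mathbb{R}^2$ be open, and let $w,y,w',y'$ be smooth real-valued functions of $(x,t)\in\Omega$ satisfying on $\Omega$ the equations (Bäcklund transformation) $$w_x+w'_x=2\eta-\tfrac1{12}(w-w')^2-\tfrac{\lambda}{12}(y-y')^2,$$ $$w_t+w'_t=\tfrac16(w-w')(w_{xx}-w'_{xx})+\tfrac{\lambda}6(y-y')(y_{xx}-y'_{xx})-\tfrac13w_x^2-\tfrac13{w'_x}^2-\tfrac13w_xw'_x-\tfrac\lambda3y_x^2-\tfrac\lambda3{y'_x}^2-\tfrac\lambda3y_xy'_x,$$ $$y_x+y'_x=2\mu-\tfrac16(w-w')(y-y'),$$ $$y_t+y'_t=\tfrac16(w-w')(y-y')_{xx}+\tfrac16(w-w')_{xx}(y-y')-\left(\tfrac23w_xy_x+\tfrac23w'_xy'_x+\tfrac13w_xy'_x+\tfrac13w'_xy_x\right).$$ Suppose moreover that $$(w-w')^2-\lambda(y-y')^2\neq0\quad\text{on }\Omega .$$ Then $(w,y)$ and $(w',y')$ are two (different) solutions on $\Omega$ of the system $$w_t+\tfrac12w_x^2+w_{xxx}+\tfrac12\lambda y_x^2=0,\qquad y_t+w_xy_x+y_{xxx}=0.$$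
   Context: Primes do not denote derivatives: $(w',y')$ is a second pair of functions. Subscripts $x,t$ denote partial derivatives. *)

theory Defs
  imports "HOL-Analysis.Analysis"
begin

text \<open>
  Being of class \<open>C\<^sup>k\<close> on a set, which is meant to be open: the derivative is taken at interior
  points, not within the set.  \<open>C\<^sup>k\<^sup>+\<^sup>1\<close> means differentiable with all directional derivatives of
  class \<open>C\<^sup>k\<close>.
\<close>
primrec Ck_on :: "nat \<Rightarrow> 'a::real_normed_vector set \<Rightarrow> ('a \<Rightarrow> 'b::real_normed_vector) \<Rightarrow> bool" where
  "Ck_on 0 S f \<longleftrightarrow> continuous_on S f"
| "Ck_on (Suc k) S f \<longleftrightarrow>
     (\<forall>p\<in>S. f differentiable (at p)) \<and> (\<forall>v. Ck_on k S (\<lambda>p. frechet_derivative f (at p) v))"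

definition smooth_on :: "'a::real_normed_vector set \<Rightarrow> ('a \<Rightarrow> 'b::real_normed_vector) \<Rightarrow> bool" where
  "smooth_on S f \<longleftrightarrow> (\<forall>k. Ck_on k S f)"

text \<open>Points of the plane are pairs \<open>(x, t)\<close>.\<close>

definition px :: "(real \<times> real \<Rightarrow> real) \<Rightarrow> real \<times> real \<Rightarrow> real" where
  "px f p = deriv (\<lambda>x. f (x, snd p)) (fst p)"

definition pt :: "(real \<times> real \<Rightarrow> real) \<Rightarrow> real \<times> real \<Rightarrow> real" where
  "pt f p = deriv (\<lambda>t. f (fst p, t)) (snd p)"

definition is_solution ::
  "real \<Rightarrow> (real \<times> real) set \<Rightarrow> (real \<times> real \<Rightarrow> real) \<Rightarrow> (real \<times> real \<Rightarrow> real) \<Rightarrow> bool" where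
  "is_solution lam \<Omega> w y \<longleftrightarrow> (\<forall>p\<in>\<Omega>.
     pt w p + 1/2 * (px w p)\<^sup>2 + px (px (px w)) p + 1/2 * lam * (px y p)\<^sup>2 = 0 \<and>
     pt y p + px w p * px y p + px (px (px y)) p = 0)"

definition baecklund ::
  "real \<Rightarrow> real \<Rightarrow> real \<Rightarrow> (real \<times> real) set \<Rightarrow> (real \<times> real \<Rightarrow> real) \<Rightarrow> (real \<times> real \<Rightarrow> real)
     \<Rightarrow> (real \<times> real \<Rightarrow> real) \<Rightarrow> (real \<times> real \<Rightarrow> real) \<Rightarrow> bool" where
  "baecklund lam \<eta> \<mu> \<Omega> w y w' y' \<longleftrightarrow> (\<forall>p\<in>\<Omega>.
     px w p + px w' p = 2 * \<eta> - 1/12 * (w p - w' p)\<^sup>2 - lam/12 * (y p - y' p)\<^sup>2 \<and>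
     pt w p + pt w' p =
         1/6 * (w p - w' p) * (px (px w) p - px (px w') p)
       + lam/6 * (y p - y' p) * (px (px y) p - px (px y') p)
       - 1/3 * (px w p)\<^sup>2 - 1/3 * (px w' p)\<^sup>2 - 1/3 * px w p * px w' p
       - lam/3 * (px y p)\<^sup>2 - lam/3 * (px y' p)\<^sup>2 - lam/3 * px y p * px y' p \<and>
     px y p + px y' p = 2 * \<mu> - 1/6 * (w p - w' p) * (y p - y' p) \<and>
     pt y p + pt y' p =
         1/6 * (w p - w' p) * px (px (\<lambda>q. y q - y' q)) p
       + 1/6 * px (px (\<lambda>q. w q - w' q)) p * (y p - y' p)
       - (2/3 * px w p * px y p + 2/3 * px w' p * px y' p
          + 1/3 * px w p * px y' p + 1/3 * px w' p * px y p))"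

end

theory Submission
  imports Defs
begin

text \<open>
  With \<open>W = w + \<surd>\<lambda> y\<close> over the algebra \<open>\<real>[\<surd>\<lambda>]\<close> the system is the potential
  KdV equation \<open>W\<^sub>t + W\<^sub>x\<^sup>2/2 + W\<^sub>x\<^sub>x\<^sub>x = 0\<close>.  Put \<open>S = W + W'\<close> and \<open>D = W - W'\<close>; the
  transformation reads \<open>S\<^sub>x = 2c - D\<^sup>2/12\<close> and
  \<open>S\<^sub>t = D D\<^sub>x\<^sub>x/6 - S\<^sub>x\<^sup>2/4 - D\<^sub>x\<^sup>2/12\<close>.  Substituting \<open>S\<^sub>x\<^sub>x\<^sub>x\<close> into the second
  equation gives the sum of the two KdV equations, while \<open>S\<^sub>x\<^sub>t = S\<^sub>t\<^sub>x\<close> gives \<open>D\<close> times their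
  difference.  The norm of \<open>D\<close> is \<open>(w - w')\<^sup>2 - \<lambda> (y - y')\<^sup>2\<close>, so \<open>D\<close> can be cancelled.
\<close>

section \<open>Smoothness depends only on values in the open set\<close>

lemma frechet_derivative_cong_open:
  assumes "open S" "p \<in> S" "f differentiable (at p)" "\<And>q. q \<in> S \<Longrightarrow> f q = g q"
  shows "g differentiable (at p)" "frechet_derivative g (at p) = frechet_derivative f (at p)"
proof -
  have "(f has_derivative frechet_derivative f (at p)) (at p)"
    using assms(3) frechet_derivative_works by blast
  then have "(g has_derivative frechet_derivative f (at p)) (at p)"
    using has_derivative_transform_within_open assms(1,2,4) by blast
  then show "g differentiable (at p)" "frechet_derivative g (at p) = frechet_derivative f (at p)"
    using frechet_derivative_at[symmetric] by (auto simp: differentiable_def)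
qed

text \<open>Derivatives at points of an open set see only nearby values. The induction generalises
  \<open>f\<close> and \<open>g\<close> because its hypothesis is applied to their directional
  derivatives.\<close>

lemma Ck_on_cong:
  assumes "open S" "\<And>q. q \<in> S \<Longrightarrow> f q = g q" "Ck_on k S f"
  shows "Ck_on k S g"
  using assms(2,3)
proof (induction k arbitrary: f g)
  case 0
  then show ?case by (auto cong: continuous_on_cong_simp)
next
  case (Suc k)
  have d: "f differentiable (at p)" if "p \<in> S" for p
    using Suc.prems(2) that by simp
  have "Ck_on k S (\<lambda>p. frechet_derivative g (at p) v)" for v
  proof (rule Suc.IH)
    show "Ck_on k S (\<lambda>p. frechet_derivative f (at p) v)" using Suc.prems(2) by simp
    show "frechet_derivative f (at q) v = frechet_derivative g (at q) v" if "q \<in> S" for q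
      using frechet_derivative_cong_open(2)[OF assms(1) that d[OF that] Suc.prems(1)] by simp
  qed
  then show ?case
    using frechet_derivative_cong_open(1)[OF assms(1) _ d Suc.prems(1)] by simp
qed

lemma smooth_on_imp_differentiable: "smooth_on S f \<Longrightarrow> p \<in> S \<Longrightarrow> f differentiable (at p)"
  unfolding smooth_on_def by (metis Ck_on.simps(2))

lemma smooth_on_imp_continuous_on: "smooth_on S f \<Longrightarrow> continuous_on S f"
  unfolding smooth_on_def by (metis Ck_on.simps(1))

text \<open>Meant for \<open>px f\<close> and \<open>pt f\<close>: being defined through
  \<open>deriv\<close>, they are identified with directional derivatives only on the set where
  \<open>f\<close> is smooth.\<close>

lemma smooth_on_directional:
  assumes "open S" "smooth_on S f" "\<And>p. p \<in> S \<Longrightarrow> g p = frechet_derivative f (at p) v"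
  shows "smooth_on S g"
proof -
  have "Ck_on k S (\<lambda>p. frechet_derivative f (at p) v)" for k
    using assms(2) unfolding smooth_on_def by (metis Ck_on.simps(2))
  then show ?thesis
    unfolding smooth_on_def using Ck_on_cong[OF assms(1)] assms(3) by metis
qed

section \<open>Partial derivatives as directional derivatives\<close>

lemma
  assumes "f differentiable (at p)"
  shows has_derivative_x_frechet:
      "((\<lambda>x. f (x, snd p)) has_real_derivative frechet_derivative f (at p) (1, 0)) (at (fst p))"
    and has_derivative_t_frechet:
      "((\<lambda>t. f (fst p, t)) has_real_derivative frechet_derivative f (at p) (0, 1)) (at (snd p))"
proof -
  let ?D = "frechet_derivative f (at p)"
  have f: "(f has_derivative ?D) (at p)"
    using assms frechet_derivative_works by blast
  then have l: "linear ?D" by (rule has_derivative_linear)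
  have "((\<lambda>x. f (x, snd p)) has_derivative (\<lambda>h. ?D (h, 0))) (at (fst p))"
    by (rule has_derivative_compose[OF has_derivative_Pair[OF has_derivative_ident has_derivative_const]])
       (simp add: f)
  moreover have "(\<lambda>h. ?D (h, 0)) = (*) (?D (1, 0))"
  proof
    fix h show "?D (h, 0) = ?D (1, 0) * h"
      using linear_scale[OF l, of h "(1, 0)"]
      unfolding scaleR_Pair real_scaleR_def mult_1_right mult_zero_right by (simp only: mult.commute)
  qed
  ultimately show "((\<lambda>x. f (x, snd p)) has_real_derivative ?D (1, 0)) (at (fst p))"
    by (simp add: has_field_derivative_def)
  have "((\<lambda>t. f (fst p, t)) has_derivative (\<lambda>h. ?D (0, h))) (at (snd p))"
    by (rule has_derivative_compose[OF has_derivative_Pair[OF has_derivative_const has_derivative_ident]])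
       (simp add: f)
  moreover have "(\<lambda>h. ?D (0, h)) = (*) (?D (0, 1))"
  proof
    fix h show "?D (0, h) = ?D (0, 1) * h"
      using linear_scale[OF l, of h "(0, 1)"]
      unfolding scaleR_Pair real_scaleR_def mult_1_right mult_zero_right by (simp only: mult.commute)
  qed
  ultimately show "((\<lambda>t. f (fst p, t)) has_real_derivative ?D (0, 1)) (at (snd p))"
    by (simp add: has_field_derivative_def)
qed

lemma
  assumes "smooth_on S f" "p \<in> S"
  shows has_derivative_px: "((\<lambda>x. f (x, snd p)) has_real_derivative px f p) (at (fst p))"
    and has_derivative_pt: "((\<lambda>t. f (fst p, t)) has_real_derivative pt f p) (at (snd p))"
    and px_frechet: "px f p = frechet_derivative f (at p) (1, 0)"
    and pt_frechet: "pt f p = frechet_derivative f (at p) (0, 1)"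
proof -
  note d = smooth_on_imp_differentiable[OF assms]
  note x = has_derivative_x_frechet[OF d] and t = has_derivative_t_frechet[OF d]
  show *: "px f p = frechet_derivative f (at p) (1, 0)" "pt f p = frechet_derivative f (at p) (0, 1)"
    unfolding px_def pt_def using DERIV_imp_deriv[OF x] DERIV_imp_deriv[OF t] by simp_all
  show "((\<lambda>x. f (x, snd p)) has_real_derivative px f p) (at (fst p))"
    "((\<lambda>t. f (fst p, t)) has_real_derivative pt f p) (at (snd p))"
    using x t * by simp_all
qed

lemma smooth_on_px: "open S \<Longrightarrow> smooth_on S f \<Longrightarrow> smooth_on S (px f)"
  using smooth_on_directional px_frechet by blast

lemma smooth_on_pt: "open S \<Longrightarrow> smooth_on S f \<Longrightarrow> smooth_on S (pt f)"
  using smooth_on_directional pt_frechet by blast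

text \<open>The slice of an open set along a coordinate line is open, so an identity holding only on
  \<open>S\<close> can still be differentiated along that line.\<close>

lemma
  assumes "open S" "p \<in> S" "\<And>q. q \<in> S \<Longrightarrow> f q = g q"
  shows has_derivative_x_cong:
      "((\<lambda>x. f (x, snd p)) has_real_derivative D) (at (fst p)) \<Longrightarrow>
       ((\<lambda>x. g (x, snd p)) has_real_derivative D) (at (fst p))"
    and has_derivative_t_cong:
      "((\<lambda>t. f (fst p, t)) has_real_derivative D) (at (snd p)) \<Longrightarrow>
       ((\<lambda>t. g (fst p, t)) has_real_derivative D) (at (snd p))"
proof -
  have x: "open ((\<lambda>x. (x, snd p)) -` S)" and t: "open ((\<lambda>t. (fst p, t)) -` S)"
    by (intro open_vimage assms continuous_intros)+
  show "((\<lambda>x. g (x, snd p)) has_real_derivative D) (at (fst p))"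
    if "((\<lambda>x. f (x, snd p)) has_real_derivative D) (at (fst p))"
    by (rule has_field_derivative_transform_within_open[OF that x]) (simp_all add: assms(2,3))
  show "((\<lambda>t. g (fst p, t)) has_real_derivative D) (at (snd p))"
    if "((\<lambda>t. f (fst p, t)) has_real_derivative D) (at (snd p))"
    by (rule has_field_derivative_transform_within_open[OF that t]) (simp_all add: assms(2,3))
qed

section \<open>Symmetry of mixed partial derivatives\<close>

lemma mixed_difference_mean_value:
  fixes f fx fxt :: "real \<Rightarrow> real \<Rightarrow> real"
  assumes "h > 0"
    and x: "\<And>x t. x \<in> {a..a+h} \<Longrightarrow> t \<in> {b..b+h} \<Longrightarrow>
      ((\<lambda>x. f x t) has_real_derivative fx x t) (at x)"
    and t: "\<And>x t. x \<in> {a..a+h} \<Longrightarrow> t \<in> {b..b+h} \<Longrightarrow>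
      ((\<lambda>t. fx x t) has_real_derivative fxt x t) (at t)"
  shows "\<exists>x\<in>{a..a+h}. \<exists>t\<in>{b..b+h}. f (a+h) (b+h) - f (a+h) b - f a (b+h) + f a b = h * h * fxt x t"
proof -
  \<comment> \<open>The second difference is the increment in \<open>x\<close> of the difference of
    two slices; one mean value step in \<open>x\<close> is followed by one in
    \<open>t\<close>.\<close>
  have "((\<lambda>x. f x (b+h) - f x b) has_real_derivative fx x (b+h) - fx x b) (at x)"
    if "a \<le> x" "x \<le> a+h" for x
    using that \<open>h > 0\<close> by (intro DERIV_diff x) auto
  with \<open>h > 0\<close> obtain x where xx: "a < x" "x < a+h"
    "f (a+h) (b+h) - f (a+h) b - (f a (b+h) - f a b) = h * (fx x (b+h) - fx x b)"
    using MVT2[of a "a+h" "\<lambda>x. f x (b+h) - f x b" "\<lambda>x. fx x (b+h) - fx x b"] by auto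
  have "((\<lambda>t. fx x t) has_real_derivative fxt x t) (at t)" if "b \<le> t" "t \<le> b+h" for t
    using that xx by (intro t) auto
  with \<open>h > 0\<close> obtain t where "b < t" "t < b+h"
    "fx x (b+h) - fx x b = h * fxt x t"
    using MVT2[of b "b+h" "fx x" "fxt x"] by auto
  with xx show ?thesis
    by (intro bexI[of _ x] bexI[of _ t]) auto
qed

text \<open>Schwarz's theorem: on a small square the same second difference is \<open>h * h\<close>
  times either mixed derivative at some point of the square, and both are continuous.\<close>

lemma px_pt_commute:
  assumes "open S" "smooth_on S f" "p \<in> S"
  shows "px (pt f) p = pt (px f) p"
proof (rule ccontr)
  assume ne: "px (pt f) p \<noteq> pt (px f) p"
  obtain a b where p: "p = (a, b)" by fastforce
  \<comment> \<open>Half the gap: a number within \<open>e\<close> of one mixed derivative at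
    \<open>p\<close> cannot also be within \<open>e\<close> of the other.\<close>
  define e where "e = \<bar>px (pt f) p - pt (px f) p\<bar> / 2"
  have "e > 0" using ne by (simp add: e_def)
  note sm = smooth_on_px[OF assms(1,2)] smooth_on_pt[OF assms(1,2)]
  have cont: "continuous_on S (px (pt f))" "continuous_on S (pt (px f))"
    using sm assms(1) smooth_on_px smooth_on_pt smooth_on_imp_continuous_on by blast+
  have "\<exists>d>0. \<forall>q\<in>S. dist q p < d \<longrightarrow> dist (g q) (g p) < e"
    if "continuous_on S g" for g :: "real \<times> real \<Rightarrow> real"
    using that \<open>e > 0\<close> assms(3) unfolding continuous_on_iff by blast
  with cont obtain d1 d2 where
    d1: "d1 > 0" "\<And>q. q \<in> S \<Longrightarrow> dist q p < d1 \<Longrightarrow> dist (px (pt f) q) (px (pt f) p) < e"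
    and d2: "d2 > 0" "\<And>q. q \<in> S \<Longrightarrow> dist q p < d2 \<Longrightarrow> dist (pt (px f) q) (pt (px f) p) < e"
    by meson
  obtain d3 where d3: "d3 > 0" "ball p d3 \<subseteq> S"
    using assms(1,3) open_contains_ball by blast
  define d where "d = min d1 (min d2 d3)"
  \<comment> \<open>With a third, the distance to \<open>p\<close> within the square is at most
    \<open>2 * h\<close>, hence below \<open>d\<close>.\<close>
  define h where "h = d / 3"
  have "d > 0" "h > 0" using d1 d2 d3 by (auto simp: d_def h_def)
  have near: "dist (x, t) p < d" if "x \<in> {a..a+h}" "t \<in> {b..b+h}" for x t
  proof -
    have "dist (x, t) p \<le> \<bar>x - a\<bar> + \<bar>t - b\<bar>"
      unfolding p dist_Pair_Pair dist_real_def using sqrt_sum_squares_le_sum_abs by simp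
    also have "\<dots> < d" using that \<open>d > 0\<close> by (auto simp: h_def)
    finally show ?thesis .
  qed
  then have inS: "(x, t) \<in> S" if "x \<in> {a..a+h}" "t \<in> {b..b+h}" for x t
    using that d3(2) by (force simp: d_def dist_commute)
  have "\<exists>x\<in>{a..a+h}. \<exists>t\<in>{b..b+h}.
    f (a+h, b+h) - f (a+h, b) - f (a, b+h) + f (a, b) = h * h * pt (px f) (x, t)"
    using has_derivative_px[OF assms(2) inS] has_derivative_pt[OF sm(1) inS]
    by (intro mixed_difference_mean_value[where f = "\<lambda>x t. f (x, t)" and fx = "\<lambda>x t. px f (x, t)"]
        \<open>h > 0\<close>) auto
  then obtain x t where xt: "x \<in> {a..a+h}" "t \<in> {b..b+h}"
    "f (a+h, b+h) - f (a+h, b) - f (a, b+h) + f (a, b) = h * h * pt (px f) (x, t)" by blast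
  \<comment> \<open>The second difference is symmetric, so the roles of \<open>x\<close> and
    \<open>t\<close> can be exchanged.\<close>
  have "\<exists>t\<in>{b..b+h}. \<exists>x\<in>{a..a+h}.
    f (a+h, b+h) - f (a, b+h) - f (a+h, b) + f (a, b) = h * h * px (pt f) (x, t)"
    using has_derivative_pt[OF assms(2) inS] has_derivative_px[OF sm(2) inS]
    by (intro mixed_difference_mean_value[where f = "\<lambda>t x. f (x, t)" and fx = "\<lambda>t x. pt f (x, t)"]
        \<open>h > 0\<close>) auto
  then obtain x' t' where xt': "x' \<in> {a..a+h}" "t' \<in> {b..b+h}"
    "f (a+h, b+h) - f (a, b+h) - f (a+h, b) + f (a, b) = h * h * px (pt f) (x', t')" by blast
  have "h * h * pt (px f) (x, t) = h * h * px (pt f) (x', t')"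
    using xt(3) xt'(3) by linarith
  then have "pt (px f) (x, t) = px (pt f) (x', t')" using \<open>h > 0\<close> by simp
  moreover have "dist (pt (px f) (x, t)) (pt (px f) p) < e"
    using d2(2)[OF inS[OF xt(1,2)]] near[OF xt(1,2)] by (simp add: d_def)
  moreover have "dist (px (pt f) (x', t')) (px (pt f) p) < e"
    using d1(2)[OF inS[OF xt'(1,2)]] near[OF xt'(1,2)] by (simp add: d_def)
  ultimately show False unfolding e_def dist_real_def by (auto simp: abs_if split: if_splits)
qed

section \<open>Differentiating identities that hold on an open set\<close>

lemma px_diff:
  assumes "smooth_on S f" "smooth_on S g" "p \<in> S"
  shows "px (\<lambda>q. f q - g q) p = px f p - px g p"
  unfolding px_def[of "\<lambda>q. f q - g q"]
  by (intro DERIV_imp_deriv derivative_intros has_derivative_px[OF _ assms(3)] assms)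

lemma px_px_diff:
  assumes "open S" "smooth_on S f" "smooth_on S g" "p \<in> S"
  shows "px (px (\<lambda>q. f q - g q)) p = px (px f) p - px (px g) p"
proof -
  have "((\<lambda>x. px f (x, snd p) - px g (x, snd p)) has_real_derivative px (px f) p - px (px g) p)
      (at (fst p))"
    using assms by (intro derivative_intros has_derivative_px[OF _ assms(4)] smooth_on_px)
  then have "((\<lambda>x. px (\<lambda>q. f q - g q) (x, snd p)) has_real_derivative px (px f) p - px (px g) p)
      (at (fst p))"
    by (rule has_derivative_x_cong[OF assms(1,4), rotated]) (simp add: px_diff[OF assms(2,3)])
  then show ?thesis unfolding px_def[of "px _"] by (rule DERIV_imp_deriv)
qed

text \<open>Uniqueness of the derivative along a coordinate line. \<open>D\<close> is left free so
  that it can be any computed form of the derivative of the explicit right-hand side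
  \<open>R\<close>.\<close>

lemma
  assumes S: "open S" "p \<in> S" and sm: "smooth_on S f" "smooth_on S g"
    and eq: "\<And>q. q \<in> S \<Longrightarrow> f q + g q = R q"
  shows px_equation:
      "((\<lambda>x. R (x, snd p)) has_real_derivative D) (at (fst p)) \<Longrightarrow> px f p + px g p = D"
    and pt_equation:
      "((\<lambda>t. R (fst p, t)) has_real_derivative D) (at (snd p)) \<Longrightarrow> pt f p + pt g p = D"
proof -
  show "px f p + px g p = D" if R: "((\<lambda>x. R (x, snd p)) has_real_derivative D) (at (fst p))"
    by (rule DERIV_unique[OF has_derivative_x_cong[OF S eq] R])
       (auto intro!: DERIV_add has_derivative_px[OF _ S(2)] sm)
  show "pt f p + pt g p = D" if R: "((\<lambda>t. R (fst p, t)) has_real_derivative D) (at (snd p))"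
    by (rule DERIV_unique[OF has_derivative_t_cong[OF S eq] R])
       (auto intro!: DERIV_add has_derivative_pt[OF _ S(2)] sm)
qed

section \<open>Cross-differentiation of the Baecklund equations\<close>

theorem theorem2:
  fixes lam \<eta> \<mu> :: real
    and \<Omega> :: "(real \<times> real) set"
    and w y w' y' :: "real \<times> real \<Rightarrow> real"
  assumes "open \<Omega>"
    and "smooth_on \<Omega> w" and "smooth_on \<Omega> y" and "smooth_on \<Omega> w'" and "smooth_on \<Omega> y'"
    and "baecklund lam \<eta> \<mu> \<Omega> w y w' y'"
    and "\<forall>p\<in>\<Omega>. (w p - w' p)\<^sup>2 - lam * (y p - y' p)\<^sup>2 \<noteq> 0"
  shows "is_solution lam \<Omega> w y \<and> is_solution lam \<Omega> w' y' \<and>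
    (\<Omega> \<noteq> {} \<longrightarrow> (\<exists>p\<in>\<Omega>. (w p, y p) \<noteq> (w' p, y' p)))"
proof -
  note op = assms(1)
  note sm0 = assms(2-5)
  \<comment> \<open>The order \<open>w\<close>, \<open>y\<close>, \<open>w'\<close>,
    \<open>y'\<close> is kept throughout: indices 1, 3 select the \<open>w\<close> pair and 2, 4 the
    \<open>y\<close> pair.\<close>
  note sm1 = sm0[THEN smooth_on_px[OF op]]
  note sm2 = sm1[THEN smooth_on_px[OF op]]
  note smt = sm0[THEN smooth_on_pt[OF op]]
  note sm = sm0 sm1 sm2 smt
  note B = assms(6)[unfolded baecklund_def, rule_format]
  have wx: "px w q + px w' q = 2 * \<eta> - 1/12 * (w q - w' q)\<^sup>2 - lam/12 * (y q - y' q)\<^sup>2"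
    and yx: "px y q + px y' q = 2 * \<mu> - 1/6 * (w q - w' q) * (y q - y' q)"
    and wt: "pt w q + pt w' q =
         1/6 * (w q - w' q) * (px (px w) q - px (px w') q)
       + lam/6 * (y q - y' q) * (px (px y) q - px (px y') q)
       - 1/3 * (px w q)\<^sup>2 - 1/3 * (px w' q)\<^sup>2 - 1/3 * px w q * px w' q
       - lam/3 * (px y q)\<^sup>2 - lam/3 * (px y' q)\<^sup>2 - lam/3 * px y q * px y' q"
    and yt: "pt y q + pt y' q =
         1/6 * (w q - w' q) * (px (px y) q - px (px y') q)
       + 1/6 * (px (px w) q - px (px w') q) * (y q - y' q)
       - (2/3 * px w q * px y q + 2/3 * px w' q * px y' q
          + 1/3 * px w q * px y' q + 1/3 * px w' q * px y q)"
    if "q \<in> \<Omega>" for q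
    using B[OF that] px_px_diff[OF op _ _ that] sm0 by simp_all
  note X = sm[THEN has_derivative_px] and T = sm0[THEN has_derivative_pt]
  \<comment> \<open>Stated at every point of \<open>\<Omega>\<close>, since these identities are
    differentiated once more below.\<close>
  have wxx: "px (px w) q + px (px w') q = - 1/6 * (w q - w' q) * (px w q - px w' q)
      - lam/6 * (y q - y' q) * (px y q - px y' q)" if q: "q \<in> \<Omega>" for q
    by (rule px_equation[OF op q sm1(1,3) wx], assumption)
       ((rule derivative_eq_intros X[OF q] refl)+, simp add: field_simps)
  have yxx: "px (px y) q + px (px y') q = - 1/6 * (px w q - px w' q) * (y q - y' q)
      - 1/6 * (w q - w' q) * (px y q - px y' q)" if q: "q \<in> \<Omega>" for q
    by (rule px_equation[OF op q sm1(2,4) yx], assumption)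
       ((rule derivative_eq_intros X[OF q] refl)+, simp add: field_simps)
  have "pt w p + 1/2 * (px w p)\<^sup>2 + px (px (px w)) p + 1/2 * lam * (px y p)\<^sup>2 = 0 \<and>
      pt y p + px w p * px y p + px (px (px y)) p = 0 \<and>
      pt w' p + 1/2 * (px w' p)\<^sup>2 + px (px (px w')) p + 1/2 * lam * (px y' p)\<^sup>2 = 0 \<and>
      pt y' p + px w' p * px y' p + px (px (px y')) p = 0" if p: "p \<in> \<Omega>" for p
  proof -
    have wxxx: "px (px (px w)) p + px (px (px w')) p =
        - 1/6 * ((px w p - px w' p)\<^sup>2 + (w p - w' p) * (px (px w) p - px (px w') p))
        - lam/6 * ((px y p - px y' p)\<^sup>2 + (y p - y' p) * (px (px y) p - px (px y') p))"
      by (rule px_equation[OF op p sm2(1,3) wxx], assumption)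
         ((rule derivative_eq_intros X[OF p] refl)+, simp add: field_simps power2_eq_square)
    have yxxx: "px (px (px y)) p + px (px (px y')) p =
        - 1/6 * (px (px w) p - px (px w') p) * (y p - y' p)
        - 1/3 * (px w p - px w' p) * (px y p - px y' p)
        - 1/6 * (w p - w' p) * (px (px y) p - px (px y') p)"
      by (rule px_equation[OF op p sm2(2,4) yxx], assumption)
         ((rule derivative_eq_intros X[OF p] refl)+, simp add: field_simps)
    \<comment> \<open>From here on, each sum is differentiated in both orders:
      \<open>S\<^sub>x\<close> in \<open>t\<close>, then \<open>S\<^sub>t\<close> in
      \<open>x\<close>.\<close>
    have wxt: "pt (px w) p + pt (px w') p = - 1/6 * (w p - w' p) * (pt w p - pt w' p)
        - lam/6 * (y p - y' p) * (pt y p - pt y' p)"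
      by (rule pt_equation[OF op p sm1(1,3) wx], assumption)
         ((rule derivative_eq_intros T[OF p] refl)+, simp add: field_simps)
    have yxt: "pt (px y) p + pt (px y') p = - 1/6 * (pt w p - pt w' p) * (y p - y' p)
        - 1/6 * (w p - w' p) * (pt y p - pt y' p)"
      by (rule pt_equation[OF op p sm1(2,4) yx], assumption)
         ((rule derivative_eq_intros T[OF p] refl)+, simp add: field_simps)
    have wtx: "px (pt w) p + px (pt w') p =
        1/6 * (px w p - px w' p) * (px (px w) p - px (px w') p)
      + 1/6 * (w p - w' p) * (px (px (px w)) p - px (px (px w')) p)
      + lam/6 * (px y p - px y' p) * (px (px y) p - px (px y') p)
      + lam/6 * (y p - y' p) * (px (px (px y)) p - px (px (px y')) p)
      - 2/3 * px w p * px (px w) p - 2/3 * px w' p * px (px w') p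
      - 1/3 * px (px w) p * px w' p - 1/3 * px w p * px (px w') p
      - 2*lam/3 * px y p * px (px y) p - 2*lam/3 * px y' p * px (px y') p
      - lam/3 * px (px y) p * px y' p - lam/3 * px y p * px (px y') p"
      by (rule px_equation[OF op p smt(1,3) wt], assumption)
         ((rule derivative_eq_intros X[OF p] refl)+, simp add: field_simps)
    have ytx: "px (pt y) p + px (pt y') p =
        1/6 * (px w p - px w' p) * (px (px y) p - px (px y') p)
      + 1/6 * (w p - w' p) * (px (px (px y)) p - px (px (px y')) p)
      + 1/6 * (px (px (px w)) p - px (px (px w')) p) * (y p - y' p)
      + 1/6 * (px (px w) p - px (px w') p) * (px y p - px y' p)
      - (2/3 * px (px w) p * px y p + 2/3 * px w p * px (px y) p
       + 2/3 * px (px w') p * px y' p + 2/3 * px w' p * px (px y') p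
       + 1/3 * px (px w) p * px y' p + 1/3 * px w p * px (px y') p
       + 1/3 * px (px w') p * px y p + 1/3 * px w' p * px (px y) p)"
      by (rule px_equation[OF op p smt(2,4) yt], assumption)
         ((rule derivative_eq_intros X[OF p] refl)+, simp add: field_simps)
    note commute = sm0[THEN px_pt_commute[OF op _ p]]
    define d e where de: "d = w p - w' p" "e = y p - y' p"
    \<comment> \<open>\<open>P\<close> and \<open>Q\<close> are the components of the difference of
      the two KdV expressions, \<open>P + \<surd>\<lambda> Q\<close>.\<close>
    define P where "P = (pt w p - pt w' p) + 1/2 * ((px w p)\<^sup>2 - (px w' p)\<^sup>2)
        + (px (px (px w)) p - px (px (px w')) p) + 1/2 * lam * ((px y p)\<^sup>2 - (px y' p)\<^sup>2)"
    define Q where "Q = (pt y p - pt y' p) + (px w p * px y p - px w' p * px y' p)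
        + (px (px (px y)) p - px (px (px y')) p)"
    \<comment> \<open>The components of \<open>D (P + \<surd>\<lambda> Q) = 0\<close>. Here
      \<open>S\<^sub>x\<^sub>t = - D D\<^sub>t/6\<close>, while
      \<open>S\<^sub>x\<^sub>x = - D D\<^sub>x/6\<close> turns \<open>S\<^sub>t\<^sub>x\<close> into
      \<open>D D\<^sub>x\<^sub>x\<^sub>x/6 + D D\<^sub>x S\<^sub>x/12\<close>, and
      \<open>S\<^sub>x D\<^sub>x\<close> is the difference of the squares of
      \<open>W\<^sub>x\<close> and \<open>W'\<^sub>x\<close>.\<close>
    have "d * P + lam * e * Q = 0"
      using wxx[OF p] yxx[OF p] wxt wtx commute unfolding P_def Q_def de by algebra
    moreover have "e * P + d * Q = 0"
      using wxx[OF p] yxx[OF p] yxt ytx commute unfolding P_def Q_def de by algebra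
    \<comment> \<open>Multiplication by the conjugate \<open>d - \<surd>\<lambda> e\<close> leaves
      the norm of \<open>D\<close> as a real factor.\<close>
    ultimately have "(d\<^sup>2 - lam * e\<^sup>2) * P = 0" "(d\<^sup>2 - lam * e\<^sup>2) * Q = 0" by algebra+
    then have "P = 0" "Q = 0" using assms(7) p by (auto simp: de)
    \<comment> \<open>The sum of the two KdV expressions: the terms in
      \<open>D D\<^sub>x\<^sub>x\<close> of \<open>S\<^sub>t\<close> and
      \<open>S\<^sub>x\<^sub>x\<^sub>x\<close> cancel, and the remaining squares match.\<close>
    moreover have "(pt w p + pt w' p) + 1/2 * ((px w p)\<^sup>2 + (px w' p)\<^sup>2)
        + (px (px (px w)) p + px (px (px w')) p) + 1/2 * lam * ((px y p)\<^sup>2 + (px y' p)\<^sup>2) = 0"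
      using wxxx wt[OF p] by (simp add: field_simps power2_eq_square)
    moreover have "(pt y p + pt y' p) + (px w p * px y p + px w' p * px y' p)
        + (px (px (px y)) p + px (px (px y')) p) = 0"
      using yxxx yt[OF p] by (simp add: field_simps)
    \<comment> \<open>Sum and difference vanish, hence so does each expression.\<close>
    ultimately show ?thesis unfolding P_def Q_def by (simp add: field_simps)
  qed
  then have "is_solution lam \<Omega> w y \<and> is_solution lam \<Omega> w' y'"
    unfolding is_solution_def by blast
  \<comment> \<open>Where the pairs coincide, the norm would be zero; they thus differ at every
    point.\<close>
  moreover have "(w p, y p) \<noteq> (w' p, y' p)" if "p \<in> \<Omega>" for p
    using assms(7) that by force
  ultimately show ?thesis by blast
qed

end
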